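(* Let $G$ be a graph with edge-disjoint cycles, i.e. any two distinct cycles of $G$ have no edge in common. Then the basis exchange walk on the graphic matroid induced by $G$ is positively curved, i.e. its Ollivier--Ricci curvature satisfies $\kappa>0$.
   Context: Graphs are finite. The graphic matroid induced by a graph $G$ has ground set the edges of $G$ and bases the spanning forests of $G$ (maximal acyclic edge sets; the spanning trees if $G$ is connected). It is assumed to have rank at least $1$ so that the walk below is defined. For a matroid $\mathcal{M}=(E,\mathcal{B})$ with set of bases $\mathcal{B}$ all of size $k$, write $B-u$ for $B\setminus\{u\}$. The basis exchange walk (down-up walk) on $\mathcal{M}$ is the Markov chain $P$ on $\mathcal{B}$ that from $S\in\mathcal{B}$ drops an element $u\in S$ chosen uniformly at random, then moves to a uniformly random basis containing $S-u$ (possibly $S$ itself). The metric on $\mathcal{B}$ is $d(S,T)=\inf\{t\ge 0: P^t(S,T)>0\}$. The Wasserstein distance is $\mathcal{W}(\mu,\nu)=\min \mathbb{E}\, d(X,Y)$, the minimum being over all couplings $(X,Y)$ of $X\sim\mu$ and $Y\sim\nu$. The Ollivier--Ricci curvature $\kappa$ of $P$ is the largest $\kappa$ such that $\mathcal{W}(P(S,\cdot),P(T,\cdot))\le(1-\kappa)\,d(S,T)$ for all $S,T\in\mathcal{B}$, i.e. $\kappa=\inf_{S\ne T}\left(1-\mathcal{W}(P(S,\cdot),P(T,\cdot))/d(S,T)\right)$ (with $\kappa=+\infty$ if there is only one basis). *)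

theory Defs
  imports "HOL-Probability.Probability"
begin

section \<open>Finite graphs, cycles and spanning forests\<close>

text \<open>
  Edges are abstract objects and \<open>ends e\<close> is the set of end vertices of \<open>e\<close>, so loops
  (one end vertex) and parallel edges are allowed. Simple graphs are the special case in which
  every edge is a two-element set of vertices and \<open>ends\<close> is the identity.
\<close>

locale finite_graph =
  fixes V :: "'v set" and E :: "'e set" and ends :: "'e \<Rightarrow> 'v set"
  assumes finite_vertices: "finite V"
    and finite_edges: "finite E"
    and ends_subset: "e \<in> E \<Longrightarrow> ends e \<subseteq> V"
    and card_ends: "e \<in> E \<Longrightarrow> card (ends e) = 1 \<or> card (ends e) = 2"

text \<open>
  A cycle is identified with its edge set. A loop is a cycle of length 1 and two distinct
  parallel edges form a cycle of length 2; distinctness of the edges matters only in the latter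
  case, where it excludes going back and forth along a single edge.
\<close>

definition is_cycle :: "'e set \<Rightarrow> ('e \<Rightarrow> 'v set) \<Rightarrow> 'e set \<Rightarrow> bool" where
  "is_cycle E ends C \<longleftrightarrow>
     C \<subseteq> E \<and>
     (\<exists>vs es. vs \<noteq> [] \<and> length es = length vs \<and> distinct vs \<and> distinct es \<and> set es = C \<and>
        (\<forall>i<length vs. ends (es ! i) = {vs ! i, vs ! ((i + 1) mod length vs)}))"

definition edge_disjoint_cycles :: "'e set \<Rightarrow> ('e \<Rightarrow> 'v set) \<Rightarrow> bool" where
  "edge_disjoint_cycles E ends \<longleftrightarrow>
     (\<forall>C D. is_cycle E ends C \<longrightarrow> is_cycle E ends D \<longrightarrow> C \<noteq> D \<longrightarrow> C \<inter> D = {})"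

definition acyclic_edges :: "'e set \<Rightarrow> ('e \<Rightarrow> 'v set) \<Rightarrow> 'e set \<Rightarrow> bool" where
  "acyclic_edges E ends F \<longleftrightarrow> F \<subseteq> E \<and> (\<nexists>C. is_cycle E ends C \<and> C \<subseteq> F)"

definition graphic_bases :: "'e set \<Rightarrow> ('e \<Rightarrow> 'v set) \<Rightarrow> 'e set set" where
  "graphic_bases E ends =
     {F. acyclic_edges E ends F \<and> (\<forall>F'. acyclic_edges E ends F' \<longrightarrow> F \<subseteq> F' \<longrightarrow> F' = F)}"


section \<open>The basis exchange walk\<close>

text \<open>
  In this section \<open>\<B>\<close> is meant to be the (finite, nonempty) set of bases of a matroid. All bases
  have the same cardinality, so the maximum below is that common value.
\<close>

definition matroid_rank :: "'e set set \<Rightarrow> nat" where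
  "matroid_rank \<B> = Max (card ` \<B>)"

definition basis_exchange_walk :: "'e set set \<Rightarrow> 'e set \<Rightarrow> 'e set pmf" where
  "basis_exchange_walk \<B> S =
     bind_pmf (pmf_of_set S) (\<lambda>u. pmf_of_set {T \<in> \<B>. S - {u} \<subseteq> T})"


section \<open>Ollivier--Ricci curvature of a Markov chain\<close>

primrec kernel_power :: "('a \<Rightarrow> 'a pmf) \<Rightarrow> nat \<Rightarrow> 'a \<Rightarrow> 'a pmf" where
  "kernel_power P 0 = return_pmf"
| "kernel_power P (Suc t) = (\<lambda>x. bind_pmf (P x) (kernel_power P t))"

text \<open>
  The infimum is taken over natural numbers, so it is the intended distance only when \<open>y\<close> is
  reachable from \<open>x\<close>. For the basis exchange walk of a matroid this always holds, by the
  exchange property.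
\<close>

definition chain_dist :: "('a \<Rightarrow> 'a pmf) \<Rightarrow> 'a \<Rightarrow> 'a \<Rightarrow> nat" where
  "chain_dist P x y = Inf {t. pmf (kernel_power P t x) y > 0}"

definition couplings :: "'a pmf \<Rightarrow> 'a pmf \<Rightarrow> ('a \<times> 'a) pmf set" where
  "couplings \<mu> \<nu> = {q. map_pmf fst q = \<mu> \<and> map_pmf snd q = \<nu>}"

definition wasserstein :: "('a \<Rightarrow> 'a \<Rightarrow> real) \<Rightarrow> 'a pmf \<Rightarrow> 'a pmf \<Rightarrow> real" where
  "wasserstein d \<mu> \<nu> =
     (INF q\<in>couplings \<mu> \<nu>. measure_pmf.expectation q (\<lambda>(x, y). d x y))"

text \<open>
  \<open>X\<close> is the state space. The value is an extended real, so that it is \<open>\<infinity>\<close> when \<open>X\<close> has only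
  one element.
\<close>

definition ollivier_ricci_curvature :: "'a set \<Rightarrow> ('a \<Rightarrow> 'a pmf) \<Rightarrow> ereal" where
  "ollivier_ricci_curvature X P =
     (INF (x, y)\<in>{(x, y). x \<in> X \<and> y \<in> X \<and> x \<noteq> y}.
        ereal (1 - wasserstein (\<lambda>a b. real (chain_dist P a b)) (P x) (P y)
                     / real (chain_dist P x y)))"

end

theory Submission
  imports Defs
begin

text \<open>
  Since the cycles are pairwise disjoint, a basis is exactly the complement of a transversal of the
  family of cycles, so the bases form a product, with one coordinate (the omitted edge) per cycle,
  and the distance \<open>d(S, T)\<close> is the number \<open>|S - T|\<close> of cycles on which the omitted edges
  differ. Let \<open>\<phi> : S \<rightarrow> T\<close> fix \<open>S \<inter> T\<close> and send the edge \<open>u \<in> S - T\<close> of a cycle \<open>C\<close> to the edge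
  of \<open>C\<close> omitted by \<open>S\<close>. Dropping \<open>u\<close> from \<open>S\<close> and \<open>\<phi> u\<close> from \<open>T\<close>, the two new bases \<open>X\<close> and \<open>Y\<close> can be
  coupled so that \<open>X - Y \<subseteq> S - T - {u}\<close>. Hence the distance never grows, and it
  drops whenever \<open>u \<in> S - T\<close>. As there are finitely many pairs of bases, this strict contraction
  is uniform.
\<close>

section \<open>Bases of a set system with pairwise disjoint circuits\<close>

locale disjoint_circuits =
  fixes E :: "'e set" and \<C> :: "'e set set"
  assumes finite_E: "finite E"
    and circuit_subset: "C \<in> \<C> \<Longrightarrow> C \<subseteq> E"
    and circuit_nonempty: "C \<in> \<C> \<Longrightarrow> C \<noteq> {}"
    and circuits_disjoint: "C \<in> \<C> \<Longrightarrow> D \<in> \<C> \<Longrightarrow> C \<noteq> D \<Longrightarrow> C \<inter> D = {}"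
begin

definition indep :: "'e set \<Rightarrow> bool" where
  "indep F \<longleftrightarrow> F \<subseteq> E \<and> (\<nexists>C. C \<in> \<C> \<and> C \<subseteq> F)"

definition bases :: "'e set set" where
  "bases = {F. indep F \<and> (\<forall>F'. indep F' \<longrightarrow> F \<subseteq> F' \<longrightarrow> F' = F)}"

lemma circuit_unique: "C \<in> \<C> \<Longrightarrow> D \<in> \<C> \<Longrightarrow> x \<in> C \<Longrightarrow> x \<in> D \<Longrightarrow> C = D"
  using circuits_disjoint by blast

text \<open>By maximality an edge \<open>x\<close> outside \<open>B\<close> closes some circuit in
  \<open>insert x B\<close>. Disjointness makes this the only circuit through \<open>x\<close>, so a
  circuit missing \<open>x\<close> misses nothing else. Conversely, an edge added to
  \<open>B\<close> lies in a circuit and completes it.\<close>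

lemma bases_iff:
  "B \<in> bases \<longleftrightarrow> B \<subseteq> E \<and> E - \<Union>\<C> \<subseteq> B \<and> (\<forall>C\<in>\<C>. \<exists>x. C - B = {x})"
proof
  assume B: "B \<in> bases"
  then have ind: "B \<subseteq> E" "\<And>C. C \<in> \<C> \<Longrightarrow> \<not> C \<subseteq> B"
    by (auto simp: bases_def indep_def)
  have closing: "\<exists>C\<in>\<C>. e \<in> C \<and> C \<subseteq> insert e B" if e: "e \<in> E - B" for e
  proof -
    have "\<not> indep (insert e B)"
      using B e by (auto simp: bases_def)
    then obtain C where "C \<in> \<C>" "C \<subseteq> insert e B"
      using e ind(1) by (auto simp: indep_def)
    moreover have "e \<in> C"
      using calculation ind(2) by blast
    ultimately show ?thesis by blast
  qed
  have "\<exists>x. C - B = {x}" if C: "C \<in> \<C>" for C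
  proof -
    obtain x where x: "x \<in> C" "x \<notin> B"
      using ind(2)[OF C] by blast
    then obtain D where "D \<in> \<C>" "x \<in> D" "D \<subseteq> insert x B"
      using closing[of x] circuit_subset[OF C] by blast
    then have "C \<subseteq> insert x B"
      using circuit_unique[OF C] x(1) by blast
    then have "C - B = {x}"
      using x by blast
    then show ?thesis ..
  qed
  then show "B \<subseteq> E \<and> E - \<Union>\<C> \<subseteq> B \<and> (\<forall>C\<in>\<C>. \<exists>x. C - B = {x})"
    using ind(1) closing by blast
next
  assume B: "B \<subseteq> E \<and> E - \<Union>\<C> \<subseteq> B \<and> (\<forall>C\<in>\<C>. \<exists>x. C - B = {x})"
  then have "indep B"
    unfolding indep_def by blast
  moreover have "F = B" if F: "indep F" "B \<subseteq> F" for F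
  proof (rule ccontr)
    assume "F \<noteq> B"
    then obtain e where e: "e \<in> F" "e \<notin> B"
      using F(2) by blast
    then obtain C where C: "C \<in> \<C>" "e \<in> C"
      using F(1) B unfolding indep_def by blast
    then obtain x where "C - B = {x}"
      using B by blast
    then have "C - B = {e}"
      using C e by auto
    then have "C - B \<subseteq> F"
      using e by simp
    then have "C \<subseteq> F"
      using F(2) by blast
    then show False
      using F(1) C by (auto simp: indep_def)
  qed
  ultimately show "B \<in> bases"
    by (auto simp: bases_def)
qed

lemma finite_basis: "B \<in> bases \<Longrightarrow> finite B"
  using bases_iff finite_E finite_subset by metis

lemma finite_bases: "finite bases"
  by (rule finite_subset[of _ "Pow E"]) (auto simp: bases_iff finite_E)

lemma basis_subset_eq: "S \<in> bases \<Longrightarrow> T \<in> bases \<Longrightarrow> S \<subseteq> T \<Longrightarrow> S = T"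
  by (auto simp: bases_def)

lemma omitted_edge:
  assumes "B \<in> bases" "C \<in> \<C>"
  shows "\<exists>s. C - B = {s}"
  using assms bases_iff by blast

lemma omitted_eq: "B \<in> bases \<Longrightarrow> C \<in> \<C> \<Longrightarrow> x \<in> C - B \<Longrightarrow> C - B = {x}"
  by (metis omitted_edge singletonD)

lemma omitted_in_circuit:
  assumes "B \<in> bases" "x \<in> E" "x \<notin> B"
  obtains C where "C \<in> \<C>" "C - B = {x}"
proof -
  obtain C where C: "C \<in> \<C>" "x \<in> C"
    using assms bases_iff by blast
  then have "C - B = {x}"
    using omitted_eq[OF assms(1) C(1)] assms(3) by simp
  with C that show ?thesis by blast
qed

section \<open>The bases reachable after dropping an element\<close>

definition exchanges :: "'e set \<Rightarrow> 'e \<Rightarrow> 'e set set" where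
  "exchanges S u = {T \<in> bases. S - {u} \<subseteq> T}"

text \<open>Only \<open>C\<close> notices the exchange: its omitted edge changes from
  \<open>s\<close> to \<open>u\<close>, while every other circuit is disjoint from \<open>C\<close>
  and contains neither edge.\<close>

lemma exchange_basis:
  assumes S: "S \<in> bases" and C: "C \<in> \<C>" "C - S = {s}" "u \<in> S \<inter> C"
  shows "insert s (S - {u}) \<in> bases"
  unfolding bases_iff
proof (intro conjI ballI)
  show "insert s (S - {u}) \<subseteq> E"
    using S C circuit_subset[OF C(1)] by (auto simp: bases_iff)
  show "E - \<Union>\<C> \<subseteq> insert s (S - {u})"
    using S C by (auto simp: bases_iff)
  fix D assume D: "D \<in> \<C>"
  show "\<exists>x. D - insert s (S - {u}) = {x}"
  proof (cases "D = C")
    case True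
    then have "D - insert s (S - {u}) = {u}"
      using C by blast
    then show ?thesis ..
  next
    case False
    then have "u \<notin> D" "s \<notin> D"
      using circuits_disjoint[OF C(1) D] C by auto
    then have "D - insert s (S - {u}) = D - S"
      by blast
    then show ?thesis
      using omitted_edge[OF S D] by simp
  qed
qed

text \<open>A completion of \<open>S - {u}\<close> either contains \<open>u\<close>, hence all of
  \<open>S\<close>, or omits \<open>u\<close> from \<open>C\<close> and must then contain
  \<open>s\<close>. In both cases the incomparability of bases gives equality.\<close>

lemma exchanges_circuit:
  assumes S: "S \<in> bases" and C: "C \<in> \<C>" "C - S = {s}" "u \<in> S \<inter> C"
  shows "exchanges S u = {S, insert s (S - {u})}"
proof
  show "{S, insert s (S - {u})} \<subseteq> exchanges S u"
    using S exchange_basis[OF assms] by (auto simp: exchanges_def)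
  show "exchanges S u \<subseteq> {S, insert s (S - {u})}"
  proof
    fix T assume "T \<in> exchanges S u"
    then have T: "T \<in> bases" "S - {u} \<subseteq> T"
      by (auto simp: exchanges_def)
    show "T \<in> {S, insert s (S - {u})}"
    proof (cases "u \<in> T")
      case True
      then show ?thesis
        using basis_subset_eq[OF S T(1)] T(2) by blast
    next
      case False
      then have "C - T = {u}"
        using omitted_eq[OF T(1) C(1)] C(3) by simp
      moreover have "s \<in> C" "s \<noteq> u"
        using C(2,3) by auto
      ultimately have "s \<in> T"
        by auto
      then have "insert s (S - {u}) \<subseteq> T"
        using T(2) by simp
      then show ?thesis
        using basis_subset_eq[OF exchange_basis[OF assms] T(1)] by simp
    qed
  qed
qed

lemma exchanges_bridge:
  assumes S: "S \<in> bases" and u: "u \<in> S" "u \<notin> \<Union>\<C>"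
  shows "exchanges S u = {S}"
proof -
  have "S = T" if T: "T \<in> bases" "S - {u} \<subseteq> T" for T
  proof -
    have "u \<in> T"
      using S T(1) u unfolding bases_iff by blast
    then show ?thesis
      using basis_subset_eq[OF S T(1)] T(2) by blast
  qed
  then show ?thesis
    using S by (auto simp: exchanges_def)
qed

section \<open>Matching the elements of two bases\<close>

text \<open>This is the map \<phi> from \<open>S\<close> to \<open>T\<close>. Disjointness of the
  circuits leaves at most one candidate in the description; a candidate exists for every
  \<open>u\<close> in \<open>S - T\<close> when \<open>S\<close> and \<open>T\<close> are
  bases.\<close>

definition swap :: "'e set \<Rightarrow> 'e set \<Rightarrow> 'e \<Rightarrow> 'e" where
  "swap S T u = (if u \<in> T then u else (THE s. \<exists>C\<in>\<C>. u \<in> C \<and> C - S = {s}))"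

lemma swap_eq:
  assumes "C \<in> \<C>" "C - S = {s}" "u \<in> C" "u \<notin> T"
  shows "swap S T u = s"
proof -
  have "(THE s. \<exists>C\<in>\<C>. u \<in> C \<and> C - S = {s}) = s"
  proof (rule the_equality)
    show "\<exists>C\<in>\<C>. u \<in> C \<and> C - S = {s}"
      using assms by blast
    fix s' assume "\<exists>D\<in>\<C>. u \<in> D \<and> D - S = {s'}"
    then obtain D where "D \<in> \<C>" "u \<in> D" "D - S = {s'}" by blast
    with assms circuit_unique[of C D u] show "s' = s" by simp
  qed
  then show ?thesis
    using assms(4) by (simp add: swap_def)
qed

text \<open>An edge missing from a basis lies on a circuit. There \<open>T\<close> omits only
  \<open>u\<close>, so the edge \<open>s\<close> omitted by \<open>S\<close>, being different from
  \<open>u\<close>, belongs to \<open>T\<close>.\<close>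

lemma differing_circuit:
  assumes "S \<in> bases" "T \<in> bases" "u \<in> S - T"
  obtains C s where "C \<in> \<C>" "C - S = {s}" "C - T = {u}" "s \<in> T - S" "swap S T u = s"
proof -
  have "u \<in> E"
    using assms bases_iff by blast
  then obtain C where C: "C \<in> \<C>" "C - T = {u}"
    using omitted_in_circuit[OF assms(2), of u] assms(3) by auto
  obtain s where s: "C - S = {s}"
    using omitted_edge[OF assms(1) C(1)] ..
  have "u \<in> C - T" "s \<in> C - S"
    using C(2) s by simp_all
  moreover from this have "s \<noteq> u"
    using assms(3) by auto
  ultimately have "s \<in> T - S"
    using C(2) by auto
  moreover have "swap S T u = s"
    using swap_eq[OF C(1) s] \<open>u \<in> C - T\<close> by simp
  ultimately show ?thesis
    using that[OF C(1) s C(2)] by simp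
qed

text \<open>Both directions use the same circuit: reversing the roles of \<open>S\<close> and
  \<open>T\<close> interchanges its two omitted edges.\<close>

lemma swap_inverse:
  assumes "S \<in> bases" "T \<in> bases" "u \<in> S"
  shows "swap S T u \<in> T" "swap T S (swap S T u) = u"
proof -
  have "swap S T u \<in> T \<and> swap T S (swap S T u) = u"
  proof (cases "u \<in> T")
    case True
    then show ?thesis
      using assms by (simp add: swap_def)
  next
    case False
    then have "u \<in> S - T"
      using assms(3) by simp
    from differing_circuit[OF assms(1,2) this] obtain C s
      where *: "C \<in> \<C>" "C - S = {s}" "C - T = {u}" "s \<in> T - S" "swap S T u = s" .
    have "swap T S s = u"
      using swap_eq[OF *(1,3), of s S] * by blast
    with * show ?thesis by simp
  qed
  then show "swap S T u \<in> T" "swap T S (swap S T u) = u" by auto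
qed

lemma bij_betw_swap:
  assumes "S \<in> bases" "T \<in> bases"
  shows "bij_betw (swap S T) S T"
  using assms swap_inverse
  by (intro bij_betw_byWitness[where f' = "swap T S"]) auto

section \<open>Coupling the completions of two bases\<close>

text \<open>The hypothesis makes both projections injective on the set of pairs, so they carry the
  uniform distribution to uniform distributions.\<close>

lemma pair_coupling:
  assumes "x = x' \<longleftrightarrow> y = y'"
  shows "pmf_of_set {(x, y), (x', y')} \<in> couplings (pmf_of_set {x, x'}) (pmf_of_set {y, y'})"
proof -
  have "inj_on fst {(x, y), (x', y')}" "inj_on snd {(x, y), (x', y')}"
    using assms by (auto simp: inj_on_def)
  then show ?thesis
    by (simp add: couplings_def map_pmf_of_set_inj)
qed

text \<open>If \<open>u\<close> is not in \<open>T\<close>, the completions are paired crosswise: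
  one basis makes its exchange while the other stays, so both pairs agree on the circuit of
  \<open>u\<close>. If \<open>u\<close> is a common edge on a circuit, both bases exchange or both
  stay. If \<open>u\<close> is on no circuit, neither can move.\<close>

lemma exchanges_coupling:
  assumes S: "S \<in> bases" and T: "T \<in> bases" and u: "u \<in> S"
  shows "\<exists>q \<in> couplings (pmf_of_set (exchanges S u)) (pmf_of_set (exchanges T (swap S T u))).
           \<forall>X Y. (X, Y) \<in> set_pmf q \<longrightarrow> X \<in> bases \<and> Y \<in> bases \<and> X - Y \<subseteq> S - T - {u}"
proof -
  \<comment> \<open>All three cases contain a pair in which \<open>S\<close> stays put; the choice
    \<open>X = S\<close>, \<open>Y = T'\<close> covers a single completion on each side.\<close>
  have pair: ?thesis
    if "X = S \<longleftrightarrow> Y = T'" "exchanges S u = {X, S}" "exchanges T (swap S T u) = {Y, T'}"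
      "X - Y \<subseteq> S - T - {u}" "S - T' \<subseteq> S - T - {u}"
    for X Y T'
  proof (rule bexI)
    show "pmf_of_set {(X, Y), (S, T')} \<in>
        couplings (pmf_of_set (exchanges S u)) (pmf_of_set (exchanges T (swap S T u)))"
      unfolding that(2,3) by (rule pair_coupling) (rule that(1))
    have "X \<in> bases" "Y \<in> bases" "T' \<in> bases"
      using that(2,3) by (auto simp: exchanges_def)
    then show "\<forall>X' Y'. (X', Y') \<in> set_pmf (pmf_of_set {(X, Y), (S, T')}) \<longrightarrow>
        X' \<in> bases \<and> Y' \<in> bases \<and> X' - Y' \<subseteq> S - T - {u}"
      using S that(4,5) by simp
  qed
  consider (diff) "u \<notin> T" | (bridge) "u \<in> T" "u \<notin> \<Union>\<C>" | (common) C where "u \<in> T" "u \<in> C" "C \<in> \<C>"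
    by blast
  then show ?thesis
  proof cases
    case diff
    then have "u \<in> S - T"
      using u by simp
    from differing_circuit[OF S T this] obtain C s
      where C: "C \<in> \<C>" "C - S = {s}" "C - T = {u}" "s \<in> T - S" "swap S T u = s" .
    have mem: "u \<in> S \<inter> C" "s \<in> T \<inter> C" "s \<notin> S"
      using C u by auto
    have "exchanges S u = {insert s (S - {u}), S}"
      using exchanges_circuit[OF S C(1,2) mem(1)] by (simp add: insert_commute)
    moreover have "exchanges T (swap S T u) = {T, insert u (T - {s})}"
      using exchanges_circuit[OF T C(1,3) mem(2)] C(5) by simp
    moreover have "insert s (S - {u}) \<noteq> S" "T \<noteq> insert u (T - {s})"
      using mem diff by auto
    moreover have "insert s (S - {u}) - T \<subseteq> S - T - {u}" "S - insert u (T - {s}) \<subseteq> S - T - {u}"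
      using mem by auto
    ultimately show ?thesis
      by (intro pair) simp_all
  next
    case bridge
    then have "exchanges S u = {S, S}" "exchanges T (swap S T u) = {T, T}"
      using exchanges_bridge S T u by (simp_all add: swap_def)
    then show ?thesis
      using bridge by (intro pair) auto
  next
    case common
    obtain s where s: "C - S = {s}"
      using omitted_edge[OF S common(3)] ..
    obtain t where t: "C - T = {t}"
      using omitted_edge[OF T common(3)] ..
    have mem: "u \<in> S \<inter> C" "u \<in> T \<inter> C" "s \<in> C - S" "t \<in> C - T"
      using s t common u by auto
    have "exchanges S u = {insert s (S - {u}), S}"
      using exchanges_circuit[OF S common(3) s mem(1)] by (simp add: insert_commute)
    moreover have "exchanges T (swap S T u) = {insert t (T - {u}), T}"
      using exchanges_circuit[OF T common(3) t mem(2)] common(1)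
      by (simp add: swap_def insert_commute)
    moreover have "insert s (S - {u}) \<noteq> S" "insert t (T - {u}) \<noteq> T"
      using mem by auto
    \<comment> \<open>The edge \<open>s\<close> either equals \<open>t\<close> or lies in
      \<open>T\<close>, as \<open>T\<close> omits only \<open>t\<close> from \<open>C\<close>. After
      both exchanges the bases omit the same edge \<open>u\<close> of \<open>C\<close>.\<close>
    moreover have "s \<in> insert t (T - {u})"
      using mem t by auto
    then have "insert s (S - {u}) - insert t (T - {u}) \<subseteq> S - T - {u}"
      using mem by auto
    moreover have "S - T \<subseteq> S - T - {u}"
      using common(1) by auto
    ultimately show ?thesis
      by (intro pair) simp_all
  qed
qed

section \<open>The distance induced by the walk\<close>

abbreviation walk :: "'e set \<Rightarrow> 'e set pmf" where
  "walk \<equiv> basis_exchange_walk bases"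

lemma walk_eq: "walk S = bind_pmf (pmf_of_set S) (\<lambda>u. pmf_of_set (exchanges S u))"
  by (simp add: basis_exchange_walk_def exchanges_def)

lemma set_walk:
  assumes "S \<in> bases" "S \<noteq> {}"
  shows "set_pmf (walk S) = (\<Union>u\<in>S. exchanges S u)"
proof -
  have "finite (exchanges S u)" "exchanges S u \<noteq> {}" for u
    using assms finite_bases by (auto simp: exchanges_def)
  then show ?thesis
    using assms finite_basis by (auto simp: walk_eq)
qed

text \<open>Positive rank in abstract form: the dropped element is always drawn from a nonempty set,
  where \<open>pmf_of_set\<close> is the uniform distribution.\<close>

context
  assumes nonempty: "{} \<notin> bases"
begin

text \<open>A step from \<open>S\<close> to \<open>X\<close> loses at most one element
  \<open>u\<close>, so \<open>S - T\<close> exceeds \<open>X - T\<close> by at most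
  \<open>u\<close>.\<close>

lemma set_kernel_power_lower:
  assumes "S \<in> bases" "T \<in> set_pmf (kernel_power walk t S)"
  shows "card (S - T) \<le> t"
  using assms
proof (induction t arbitrary: S)
  case 0
  then show ?case by simp
next
  case (Suc t)
  then obtain X where X: "X \<in> set_pmf (walk S)" "T \<in> set_pmf (kernel_power walk t X)"
    by auto
  have "S \<noteq> {}"
    using Suc.prems nonempty by blast
  then obtain u where u: "X \<in> bases" "S - {u} \<subseteq> X"
    using X(1) set_walk Suc.prems by (auto simp: exchanges_def)
  have "card (S - T) \<le> card (insert u (X - T))"
    using u finite_basis by (intro card_mono) auto
  also have "\<dots> \<le> Suc (card (X - T))"
    by (rule card_insert_le_m1) auto
  also have "\<dots> \<le> Suc t"
    using Suc.IH[OF u(1) X(2)] by simp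
  finally show ?case .
qed

text \<open>As long as \<open>S\<close> differs from \<open>T\<close>, one exchange on a circuit
  where they omit different edges makes them agree there and lowers the difference by one.\<close>

lemma set_kernel_power_upper:
  assumes "S \<in> bases" "T \<in> bases"
  shows "T \<in> set_pmf (kernel_power walk (card (S - T)) S)"
  using assms
proof (induction "card (S - T)" arbitrary: S)
  case 0
  then have "S = T"
    using basis_subset_eq[of S T] finite_basis by auto
  then show ?case by simp
next
  case (Suc t)
  then have "S - T \<noteq> {}"
    by (metis card.empty nat.distinct(1))
  then obtain u where u: "u \<in> S - T"
    by blast
  from differing_circuit[OF Suc.prems u] obtain C s
    where C: "C \<in> \<C>" "C - S = {s}" "C - T = {u}" "s \<in> T - S" .
  define X where "X = insert s (S - {u})"
  have XT: "X - T = (S - T) - {u}"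
    using C by (auto simp: X_def)
  then have t: "t = card (X - T)"
    using Suc.hyps(2) u by simp
  have X: "X \<in> exchanges S u"
    using exchanges_circuit[OF Suc.prems(1) C(1,2)] C u by (auto simp: X_def)
  then have "X \<in> set_pmf (walk S)"
    using set_walk Suc.prems(1) u by blast
  moreover have "T \<in> set_pmf (kernel_power walk t X)"
    using Suc.hyps(1)[OF t] X Suc.prems(2) t by (auto simp: exchanges_def)
  ultimately show ?case
    unfolding Suc.hyps(2)[symmetric] by auto
qed

lemma chain_dist_walk:
  assumes "S \<in> bases" "T \<in> bases"
  shows "chain_dist walk S T = card (S - T)"
  unfolding chain_dist_def
proof (rule cInf_eq_minimum)
  show "card (S - T) \<in> {t. 0 < pmf (kernel_power walk t S) T}"
    using set_kernel_power_upper[OF assms] by (simp add: pmf_positive_iff)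
  fix t assume "t \<in> {t. 0 < pmf (kernel_power walk t S) T}"
  then show "card (S - T) \<le> t"
    using set_kernel_power_lower[OF assms(1)] by (simp add: pmf_positive_iff)
qed

section \<open>Coupling one step of the walk and strict contraction\<close>

text \<open>Draw \<open>u\<close> uniformly from \<open>S\<close>, drop \<open>u\<close> from
  \<open>S\<close> and \<open>swap S T u\<close> from \<open>T\<close>, then couple the completions.
  The last conclusion, taken at an element of \<open>S - T\<close>, supplies a pair of positive
  probability that is strictly closer.\<close>

lemma walk_coupling:
  assumes S: "S \<in> bases" and T: "T \<in> bases"
  obtains q where "q \<in> couplings (walk S) (walk T)"
    "\<And>X Y. (X, Y) \<in> set_pmf q \<Longrightarrow> X \<in> bases \<and> Y \<in> bases \<and> X - Y \<subseteq> S - T"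
    "\<And>u. u \<in> S \<Longrightarrow> \<exists>(X, Y) \<in> set_pmf q. X - Y \<subseteq> S - T - {u}"
proof -
  have ne: "S \<noteq> {}" "finite S"
    using S nonempty finite_basis by auto
  let ?good = "\<lambda>u q. q \<in> couplings (pmf_of_set (exchanges S u)) (pmf_of_set (exchanges T (swap S T u))) \<and>
    (\<forall>X Y. (X, Y) \<in> set_pmf q \<longrightarrow> X \<in> bases \<and> Y \<in> bases \<and> X - Y \<subseteq> S - T - {u})"
  have "\<forall>u\<in>S. \<exists>q. ?good u q"
    using exchanges_coupling[OF S T] by blast
  from bchoice[OF this] obtain K where "\<forall>u\<in>S. ?good u (K u)" ..
  then have K: "\<And>u. u \<in> S \<Longrightarrow>
      K u \<in> couplings (pmf_of_set (exchanges S u)) (pmf_of_set (exchanges T (swap S T u)))"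
    "\<And>u X Y. u \<in> S \<Longrightarrow> (X, Y) \<in> set_pmf (K u) \<Longrightarrow>
      X \<in> bases \<and> Y \<in> bases \<and> X - Y \<subseteq> S - T - {u}"
    by blast+
  define q where "q = bind_pmf (pmf_of_set S) K"
  have "map_pmf fst q = walk S"
    unfolding q_def map_bind_pmf walk_eq
    using K(1) ne by (intro bind_pmf_cong) (auto simp: couplings_def)
  moreover have "map_pmf snd q = walk T"
  proof -
    have "map_pmf snd q =
        bind_pmf (pmf_of_set S) (\<lambda>u. pmf_of_set (exchanges T (swap S T u)))"
      unfolding q_def map_bind_pmf
      using K(1) ne by (intro bind_pmf_cong) (auto simp: couplings_def)
    also have "\<dots> = bind_pmf (map_pmf (swap S T) (pmf_of_set S)) (\<lambda>v. pmf_of_set (exchanges T v))"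
      by (simp add: bind_map_pmf)
    \<comment> \<open>The second marginal is right because a bijection makes the element dropped
      from \<open>T\<close> uniform.\<close>
    also have "map_pmf (swap S T) (pmf_of_set S) = pmf_of_set T"
      using bij_betw_swap[OF S T] ne by (rule map_pmf_of_set_bij_betw)
    finally show ?thesis
      by (simp add: walk_eq)
  qed
  ultimately have "q \<in> couplings (walk S) (walk T)"
    by (simp add: couplings_def)
  moreover have q: "set_pmf q = (\<Union>u\<in>S. set_pmf (K u))"
    using ne by (simp add: q_def)
  moreover have "\<exists>(X, Y) \<in> set_pmf q. X - Y \<subseteq> S - T - {u}" if "u \<in> S" for u
  proof -
    obtain X Y where XY: "(X, Y) \<in> set_pmf (K u)"
      using set_pmf_not_empty[of "K u"] by fastforce
    then have "(X, Y) \<in> set_pmf q"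
      using q that by blast
    then show ?thesis
      using K(2)[OF that XY] by blast
  qed
  moreover have "X \<in> bases \<and> Y \<in> bases \<and> X - Y \<subseteq> S - T" if "(X, Y) \<in> set_pmf q" for X Y
  proof -
    obtain u where "u \<in> S" "(X, Y) \<in> set_pmf (K u)"
      using q \<open>(X, Y) \<in> set_pmf q\<close> by blast
    then show ?thesis
      using K(2) by blast
  qed
  ultimately show ?thesis
    using that by blast
qed

text \<open>The cost of the coupling is an average of distances at most \<open>card (S - T)\<close>,
  one of which is smaller and has positive weight.\<close>

lemma wasserstein_walk_less:
  assumes S: "S \<in> bases" and T: "T \<in> bases" and "S \<noteq> T"
  shows "wasserstein (\<lambda>x y. real (chain_dist walk x y)) (walk S) (walk T)
           < real (chain_dist walk S T)"
proof -
  let ?d = "\<lambda>(x, y). real (chain_dist walk x y)"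
  let ?c = "real (card (S - T))"
  obtain q where q: "q \<in> couplings (walk S) (walk T)"
    "\<And>X Y. (X, Y) \<in> set_pmf q \<Longrightarrow> X \<in> bases \<and> Y \<in> bases \<and> X - Y \<subseteq> S - T"
    "\<And>u. u \<in> S \<Longrightarrow> \<exists>(X, Y) \<in> set_pmf q. X - Y \<subseteq> S - T - {u}"
    using walk_coupling[OF S T] by metis
  obtain u where u: "u \<in> S" "u \<notin> T"
    using basis_subset_eq[OF S T] \<open>S \<noteq> T\<close> by blast
  have fin: "finite (S - T)"
    using finite_basis[OF S] by simp
  have finq: "finite (set_pmf q)"
    by (rule finite_subset[of _ "bases \<times> bases"]) (use q(2) finite_bases in auto)
  have le: "?d z \<le> ?c" if "z \<in> set_pmf q" for z
    using q(2) that card_mono[OF fin] by (cases z) (auto simp: chain_dist_walk)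
  have less: "\<exists>z\<in>set_pmf q. ?d z < ?c"
  proof -
    obtain X Y where XY: "(X, Y) \<in> set_pmf q" "X - Y \<subseteq> S - T - {u}"
      using q(3)[OF u(1)] by blast
    then have "X - Y \<subset> S - T"
      using u by blast
    then have "card (X - Y) < card (S - T)"
      by (rule psubset_card_mono[OF fin])
    then have "?d (X, Y) < ?c"
      using q(2)[OF XY(1)] by (simp add: chain_dist_walk)
    with XY(1) show ?thesis by blast
  qed
  have "wasserstein (\<lambda>x y. real (chain_dist walk x y)) (walk S) (walk T)
      \<le> measure_pmf.expectation q ?d"
    unfolding wasserstein_def
    \<comment> \<open>The infimum over couplings is bounded below by 0 because distances are
      nonnegative.\<close>
    by (rule cINF_lower[OF _ q(1)]) (auto intro!: bdd_belowI2[where m = 0] integral_nonneg_AE)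
  also have "\<dots> = (\<Sum>z\<in>set_pmf q. ?d z * pmf q z)"
    by (rule integral_measure_pmf_real[OF finq]) auto
  also have "\<dots> < (\<Sum>z\<in>set_pmf q. ?c * pmf q z)"
    using finq le less
    by (intro sum_strict_mono_ex1) (auto intro!: mult_right_mono simp: pmf_positive)
  also have "\<dots> = ?c"
    by (simp add: sum_distrib_left[symmetric] sum_pmf_eq_1[OF finq])
  finally show ?thesis
    by (simp add: chain_dist_walk[OF S T])
qed

lemma walk_positively_curved: "ollivier_ricci_curvature bases walk > 0"
proof -
  define A where "A = {(x, y). x \<in> bases \<and> y \<in> bases \<and> x \<noteq> y}"
  define f where "f = (\<lambda>(x, y). ereal (1 - wasserstein (\<lambda>a b. real (chain_dist walk a b))
      (walk x) (walk y) / real (chain_dist walk x y)))"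
  have "finite A"
    by (rule finite_subset[of _ "bases \<times> bases"]) (auto simp: A_def finite_bases)
  have pos: "0 < f z" if zA: "z \<in> A" for z
  proof -
    obtain x y where z: "z = (x, y)" "x \<in> bases" "y \<in> bases" "x \<noteq> y"
      using zA by (auto simp: A_def)
    have "card (x - y) > 0"
      using z basis_subset_eq[of x y] finite_basis[of x] by (auto simp: card_gt_0_iff)
    then have "chain_dist walk x y > 0"
      by (simp add: chain_dist_walk z)
    then show ?thesis
      using wasserstein_walk_less[OF z(2-4)] by (simp add: f_def z(1))
  qed
  have "0 < (INF z\<in>A. f z)"
  proof (cases "A = {}")
    \<comment> \<open>With at most one basis the infimum over the empty set is \<infinity>.\<close>
    case True
    then show ?thesis by (simp add: top_ereal_def)
  next
    case False
    \<comment> \<open>Finiteness makes the infimum a minimum; an infimum of positive values that is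
      not attained could be 0.\<close>
    then have "(INF z\<in>A. f z) \<in> f ` A"
      using Min_in[of "f ` A"] Min_Inf[of "f ` A"] \<open>finite A\<close> by simp
    then show ?thesis
      using pos by auto
  qed
  then show ?thesis
    by (simp add: ollivier_ricci_curvature_def A_def f_def)
qed

end

end

section \<open>Application to graphs\<close>

theorem lemma4p6:
  fixes V :: "'v set" and E :: "'e set" and ends :: "'e \<Rightarrow> 'v set"
  assumes "finite_graph V E ends"
    and "edge_disjoint_cycles E ends"
    and "matroid_rank (graphic_bases E ends) \<ge> 1"
  shows "ollivier_ricci_curvature (graphic_bases E ends)
           (basis_exchange_walk (graphic_bases E ends)) > 0"
proof -
  interpret disjoint_circuits E "{C. is_cycle E ends C}"
  proof
    show "finite E"
      using assms(1) by (rule finite_graph.finite_edges)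
  qed (use assms(2) in \<open>auto simp: is_cycle_def edge_disjoint_cycles_def\<close>)
  have eq: "graphic_bases E ends = bases"
    by (simp add: graphic_bases_def bases_def acyclic_edges_def indep_def)
  have "{} \<notin> bases"
  proof
    \<comment> \<open>Bases are incomparable, so an empty basis would be the only one and the rank
      would be 0.\<close>
    assume "{} \<in> bases"
    then have "bases = {{}}"
      using basis_subset_eq by blast
    then show False
      using assms(3) by (simp add: eq matroid_rank_def)
  qed
  then show ?thesis
    unfolding eq by (rule walk_positively_curved)
qed

end
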